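(* Let $d\in[1,+\infty]$ and let $(\varphi_{s,t})_{0\le s\le t<+\infty}$ be an evolution family of order $d$ in the unit disc $\mathbb{D}$. Then every $\varphi_{s,t}$ is univalent (i.e. injective on $\mathbb{D}$).
   Context: $\mathbb{D}=\{\zeta\in\mathbb{C}:|\zeta|<1\}$. For $d\in[1,+\infty]$, a family $(\varphi_{s,t})_{0\le s\le t<+\infty}$ of holomorphic self-maps of $\mathbb{D}$ is an evolution family of order $d$ if (1) $\varphi_{s,s}=\mathrm{id}_{\mathbb{D}}$ for all $s\ge 0$; (2) $\varphi_{s,t}=\varphi_{u,t}\circ\varphi_{s,u}$ for all $0\le s\le u\le t<+\infty$; (3) for all $z\in\mathbb{D}$ and all $T>0$ there is a non-negative $k_{z,T}\in L^d([0,T],\mathbb{R})$ with $|\varphi_{s,u}(z)-\varphi_{s,t}(z)|\le\int_u^t k_{z,T}(\xi)\,d\xi$ for all $0\le s\le u\le t\le T$. *)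

theory Defs
  imports "HOL-Complex_Analysis.Complex_Analysis" "HOL-Probability.Essential_Supremum"
begin

abbreviation unit_disc :: "complex set" where
  "unit_disc \<equiv> ball 0 1"

definition in_Lp :: "ennreal \<Rightarrow> 'a measure \<Rightarrow> ('a \<Rightarrow> real) \<Rightarrow> bool" where
  "in_Lp d M f \<longleftrightarrow> f \<in> borel_measurable M \<and>
     (if d = \<infinity> then esssup M (\<lambda>x. ereal \<bar>f x\<bar>) < \<infinity>
      else integrable M (\<lambda>x. \<bar>f x\<bar> powr enn2real d))"

(* phi s t is constrained only for 0 <= s <= t and on the unit disc; its other values are junk. *)
definition evolution_family :: "ennreal \<Rightarrow> (real \<Rightarrow> real \<Rightarrow> complex \<Rightarrow> complex) \<Rightarrow> bool" where
  "evolution_family d \<phi> \<longleftrightarrow>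
     (\<forall>s t. 0 \<le> s \<and> s \<le> t \<longrightarrow> \<phi> s t holomorphic_on unit_disc \<and> \<phi> s t ` unit_disc \<subseteq> unit_disc) \<and>
     (\<forall>s\<ge>0. \<forall>z\<in>unit_disc. \<phi> s s z = z) \<and>
     (\<forall>s u t. 0 \<le> s \<and> s \<le> u \<and> u \<le> t \<longrightarrow> (\<forall>z\<in>unit_disc. \<phi> s t z = \<phi> u t (\<phi> s u z))) \<and>
     (\<forall>z\<in>unit_disc. \<forall>T>0. \<exists>k :: real \<Rightarrow> real.
        (\<forall>\<xi>\<in>{0..T}. 0 \<le> k \<xi>) \<and> in_Lp d (lebesgue_on {0..T}) k \<and>
        (\<forall>s u t. 0 \<le> s \<and> s \<le> u \<and> u \<le> t \<and> t \<le> T \<longrightarrow>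
           cmod (\<phi> s u z - \<phi> s t z) \<le> (LINT \<xi>:{u..t}|lebesgue. k \<xi>)))"

end

theory Submission
  imports Defs
begin

text \<open>
  Two distinct points \<open>z\<close>, \<open>w\<close> move along the trajectories \<open>u \<mapsto> \<phi> s u z\<close> and
  \<open>u \<mapsto> \<phi> s u w\<close>, and injectivity says that these never meet. Suppose that they do. The
  trajectories are continuous (\<open>evolution_family_modulus\<close>), so there is a first meeting time
  \<open>v > s\<close>. For \<open>s \<le> u < v\<close> the two trajectories occupy distinct points at time \<open>u\<close>, and the
  transition map \<open>\<phi> u v\<close> sends both of them to the meeting point; hence \<open>\<phi> u v\<close> is not
  injective on a compact convex set \<open>K\<close> containing both trajectories.

  On the other hand, as \<open>u\<close> increases to \<open>v\<close> the maps \<open>\<phi> u v\<close> tend pointwise to the identity, by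
  the modulus of continuity applied at the starting time \<open>u\<close>. They are uniformly bounded, so by
  Montel's theorem and the Cauchy estimates the derivatives of \<open>\<phi> u v - id\<close> become small on
  \<open>K\<close>, which forces \<open>\<phi> u v\<close> to be injective on \<open>K\<close> for \<open>u\<close> close to \<open>v\<close>
  (\<open>eventually_inj_on_if_tendsto_id\<close>): a contradiction.

  The order \<open>d\<close> enters only through the inclusion of \<open>L\<^sup>d\<close> in \<open>L\<^sup>1\<close> on bounded intervals, which
  makes the increment bound a difference of values of one continuous function.
\<close>

text \<open>On a finite measure space the bounded functions are integrable, which settles \<open>d = \<infinity>\<close>; for
  finite \<open>d\<close> the function is dominated by \<open>1 + \<bar>f\<bar> powr d\<close>.\<close>

lemma in_Lp_imp_integrable:
  assumes "finite_measure M" "1 \<le> d" "in_Lp d M f"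
  shows "integrable M f"
proof -
  interpret finite_measure M by fact
  have meas: "f \<in> borel_measurable M"
    using assms(3) by (simp add: in_Lp_def)
  show ?thesis
  proof (cases "d = \<infinity>")
    case True
    define c where "c = esssup M (\<lambda>x. ereal \<bar>f x\<bar>)"
    have "c < \<infinity>"
      using assms(3) True by (simp add: in_Lp_def c_def)
    then obtain B where B: "c \<le> ereal B"
      by (cases c) auto
    have "AE x in M. ereal \<bar>f x\<bar> \<le> c"
      unfolding c_def by (rule esssup_AE)
    then have "AE x in M. norm (f x) \<le> B"
    proof eventually_elim
      case (elim x)
      then have "ereal \<bar>f x\<bar> \<le> ereal B" using B by (rule order_trans)
      then show ?case by simp
    qed
    then show ?thesis using meas by (rule integrable_const_bound)
  next
    case False
    define p where "p = enn2real d"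
    have p: "1 \<le> p"
      using assms(2) False unfolding p_def
      by (metis enn2real_1 enn2real_mono infinity_ennreal_def top.not_eq_extremum)
    have "integrable M (\<lambda>x. \<bar>f x\<bar> powr p)"
      using assms(3) False by (simp add: in_Lp_def p_def)
    then have "integrable M (\<lambda>x. 1 + \<bar>f x\<bar> powr p)"
      by simp
    then show ?thesis
    proof (rule Bochner_Integration.integrable_bound[OF _ meas], intro AE_I2)
      fix x
      show "norm (f x) \<le> norm (1 + \<bar>f x\<bar> powr p)"
      proof (cases "\<bar>f x\<bar> \<le> 1")
        case False
        then have "\<bar>f x\<bar> powr 1 \<le> \<bar>f x\<bar> powr p"
          using p by (intro powr_mono) auto
        then show ?thesis using False by simp
      qed (auto intro: order_trans[of _ 1])
    qed
  qed
qed

text \<open>Taking for \<open>K\<close> the indefinite integral of the \<open>L\<^sup>d\<close> bound gives a modulus of continuity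
  which does not depend on the starting time \<open>s\<close>. This uniformity is what allows the
  starting time to vary while the end time is held fixed.\<close>

lemma evolution_family_modulus:
  assumes "1 \<le> d" "evolution_family d \<phi>" "z \<in> unit_disc" "0 < T"
  shows "\<exists>K :: real \<Rightarrow> real. continuous_on {0..T} K \<and>
    (\<forall>s u t. 0 \<le> s \<and> s \<le> u \<and> u \<le> t \<and> t \<le> T \<longrightarrow> cmod (\<phi> s u z - \<phi> s t z) \<le> K t - K u)"
proof -
  obtain k where k: "in_Lp d (lebesgue_on {0..T}) k"
      "\<And>s u t. 0 \<le> s \<Longrightarrow> s \<le> u \<Longrightarrow> u \<le> t \<Longrightarrow> t \<le> T \<Longrightarrow>
           cmod (\<phi> s u z - \<phi> s t z) \<le> (LINT \<xi>:{u..t}|lebesgue. k \<xi>)"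
    using assms unfolding evolution_family_def by meson
  have "finite_measure (lebesgue_on {0..T})"
    by (intro finite_measure_lebesgue_on) auto
  then have "integrable (lebesgue_on {0..T}) k"
    using k(1) assms(1) by (intro in_Lp_imp_integrable)
  then have si: "set_integrable lebesgue {0..T} k"
    by (simp add: integrable_restrict_space set_integrable_def)
  then have ki: "k integrable_on {0..T}"
    by (rule set_lebesgue_integral_eq_integral)
  show ?thesis
  proof (intro exI[of _ "\<lambda>x. integral {0..x} k"] conjI allI impI)
    show "continuous_on {0..T} (\<lambda>x. integral {0..x} k)"
      using ki by (rule indefinite_integral_continuous_1)
    fix s u t :: real
    assume "0 \<le> s \<and> s \<le> u \<and> u \<le> t \<and> t \<le> T"
    then have *: "0 \<le> s" "s \<le> u" "u \<le> t" "t \<le> T" by auto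
    have "set_integrable lebesgue {u..t} k"
      by (rule set_integrable_subset[OF si]) (use * in auto)
    then have "(LINT \<xi>:{u..t}|lebesgue. k \<xi>) = integral {u..t} k"
      by (rule set_lebesgue_integral_eq_integral)
    moreover have "integral {0..u} k + integral {u..t} k = integral {0..t} k"
      using * by (intro Henstock_Kurzweil_Integration.integral_combine
          integrable_subinterval_real[OF ki]) auto
    ultimately show "cmod (\<phi> s u z - \<phi> s t z) \<le> integral {0..t} k - integral {0..u} k"
      using k(2)[OF *] by simp
  qed
qed

text \<open>If \<open>h\<close> is close to the identity on the closed \<open>e\<close>-neighbourhood of \<open>K\<close>, the Cauchy estimate
  makes \<open>h - id\<close> a contraction on \<open>K\<close>, and a contractive perturbation of the identity is
  injective. Convexity of \<open>K\<close> turns the derivative bound into the Lipschitz bound.\<close>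

lemma inj_on_if_close_to_id:
  fixes h :: "complex \<Rightarrow> complex"
  assumes "open S" "h holomorphic_on S" "convex K" "0 < e" "(\<Union>x\<in>K. cball x e) \<subseteq> S"
    and close: "\<And>x. x \<in> (\<Union>x\<in>K. cball x e) \<Longrightarrow> cmod (h x - x) \<le> e / 2"
  shows "inj_on h K"
proof (rule inj_onI)
  fix x y assume xy: "x \<in> K" "y \<in> K" "h x = h y"
  define g where "g = (\<lambda>x. h x - x)"
  have g: "g holomorphic_on S"
    unfolding g_def by (intro holomorphic_intros assms)
  have KS: "cball a e \<subseteq> S" if "a \<in> K" for a
    using that assms(5) by blast
  have der: "cmod (deriv g a) \<le> 1 / 2" if a: "a \<in> K" for a
  proof -
    have "norm ((deriv ^^ 1) g a) \<le> fact 1 * (e / 2) / e ^ 1"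
    proof (rule Cauchy_inequality)
      show "g holomorphic_on ball a e"
        using g KS[OF a] ball_subset_cball holomorphic_on_subset by blast
      show "continuous_on (cball a e) g"
        using g KS[OF a] holomorphic_on_imp_continuous_on continuous_on_subset by blast
      show "norm (g x) \<le> e / 2" if "norm (a - x) = e" for x
        unfolding g_def by (rule close) (use that a in \<open>auto simp: dist_norm\<close>)
    qed fact
    then show ?thesis using \<open>0 < e\<close> by simp
  qed
  have "norm (g x - g y) \<le> 1 / 2 * norm (x - y)"
  proof (rule field_differentiable_bound[OF \<open>convex K\<close> _ der])
    fix a assume "a \<in> K"
    then have "a \<in> S" using KS[of a] \<open>0 < e\<close> by auto
    then show "(g has_field_derivative deriv g a) (at a within K)"
      using g \<open>open S\<close> holomorphic_derivI by blast
  qed (use xy in auto)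
  moreover have "norm (g x - g y) = norm (x - y)"
    using xy(3) by (simp add: g_def norm_minus_commute)
  ultimately show "x = y" by simp
qed

text \<open>Montel's theorem upgrades pointwise to locally uniform convergence along subsequences, which
  is enough: a failure of the conclusion would produce a subsequence of maps none of which is
  injective on \<open>K\<close>.\<close>

lemma eventually_inj_on_if_tendsto_id:
  fixes f :: "nat \<Rightarrow> complex \<Rightarrow> complex"
  assumes "open S" "\<And>n. f n holomorphic_on S"
    and bounded: "\<And>n x. x \<in> S \<Longrightarrow> cmod (f n x) \<le> B"
    and lim: "\<And>x. x \<in> S \<Longrightarrow> (\<lambda>n. f n x) \<longlonglongrightarrow> x"
    and K: "compact K" "convex K" "K \<subseteq> S"
  shows "\<forall>\<^sub>F n in sequentially. inj_on (f n) K"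
proof (rule ccontr)
  assume "\<not> ?thesis"
  then have "infinite {n. \<not> inj_on (f n) K}"
    unfolding cofinite_eq_sequentially[symmetric] eventually_cofinite .
  then obtain \<sigma> :: "nat \<Rightarrow> nat" where \<sigma>: "strict_mono \<sigma>" "\<And>n. \<not> inj_on (f (\<sigma> n)) K"
    using infinite_enumerate by blast
  obtain g r where gr: "strict_mono (r :: nat \<Rightarrow> nat)"
      "\<And>x. x \<in> S \<Longrightarrow> (\<lambda>n. (f \<circ> \<sigma>) (r n) x) \<longlonglongrightarrow> g x"
      "\<And>L. compact L \<Longrightarrow> L \<subseteq> S \<Longrightarrow> uniform_limit L ((f \<circ> \<sigma>) \<circ> r) g sequentially"
  proof (rule Montel[OF \<open>open S\<close>, of "range f" "f \<circ> \<sigma>"])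
    show "\<exists>B. \<forall>h\<in>range f. \<forall>z\<in>L. cmod (h z) \<le> B" if "compact L" "L \<subseteq> S" for L
      using bounded that by blast
  qed (use assms(2) in auto)
  have gid: "g x = x" if "x \<in> S" for x
  proof -
    have "(\<lambda>n. f ((\<sigma> \<circ> r) n) x) \<longlonglongrightarrow> x"
      using LIMSEQ_subseq_LIMSEQ[OF lim[OF that], of "\<sigma> \<circ> r"] strict_mono_o[OF \<sigma>(1) gr(1)]
      by (simp add: o_def)
    then show ?thesis
      using gr(2)[OF that] LIMSEQ_unique by (auto simp: o_def)
  qed
  obtain e where e: "0 < e" "(\<Union>x\<in>K. cball x e) \<subseteq> S"
    using compact_subset_open_imp_cball_epsilon_subset[OF K(1) \<open>open S\<close> K(3)] by metis
  have "uniform_limit (\<Union>x\<in>K. cball x e) ((f \<circ> \<sigma>) \<circ> r) g sequentially"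
    using gr(3) compact_minkowski_sum_cball[OF K(1)] e(2) by blast
  then have "\<forall>\<^sub>F n in sequentially. \<forall>x\<in>(\<Union>x\<in>K. cball x e). dist (((f \<circ> \<sigma>) \<circ> r) n x) (g x) < e / 2"
    by (rule uniform_limitD) (use e in simp)
  then obtain n where "\<forall>x\<in>(\<Union>x\<in>K. cball x e). dist (((f \<circ> \<sigma>) \<circ> r) n x) (g x) < e / 2"
    using eventually_happens'[OF sequentially_bot] by blast
  then have n: "dist (f (\<sigma> (r n)) x) (g x) < e / 2" if "x \<in> (\<Union>x\<in>K. cball x e)" for x
    using that unfolding o_def by blast
  have "inj_on (f (\<sigma> (r n))) K"
  proof (rule inj_on_if_close_to_id[OF \<open>open S\<close> assms(2) K(2) e])
    fix x assume x: "x \<in> (\<Union>x\<in>K. cball x e)"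
    then have "x \<in> S" using e(2) by blast
    then show "cmod (f (\<sigma> (r n)) x - x) \<le> e / 2"
      using n[OF x] gid by (simp add: dist_norm)
  qed
  with \<sigma>(2) show False by blast
qed

lemma evolution_familyD:
  assumes "evolution_family d \<phi>"
  shows "0 \<le> s \<Longrightarrow> s \<le> t \<Longrightarrow> \<phi> s t holomorphic_on unit_disc"
    and "0 \<le> s \<Longrightarrow> s \<le> t \<Longrightarrow> z \<in> unit_disc \<Longrightarrow> \<phi> s t z \<in> unit_disc"
    and "0 \<le> s \<Longrightarrow> z \<in> unit_disc \<Longrightarrow> \<phi> s s z = z"
    and "0 \<le> s \<Longrightarrow> s \<le> u \<Longrightarrow> u \<le> t \<Longrightarrow> z \<in> unit_disc \<Longrightarrow> \<phi> s t z = \<phi> u t (\<phi> s u z)"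
proof -
  note ev = assms[unfolded evolution_family_def]
  note self_map = ev[THEN conjunct1, rule_format]
  show "0 \<le> s \<Longrightarrow> s \<le> t \<Longrightarrow> \<phi> s t holomorphic_on unit_disc"
    using self_map[of s t] by simp
  show "0 \<le> s \<Longrightarrow> s \<le> t \<Longrightarrow> z \<in> unit_disc \<Longrightarrow> \<phi> s t z \<in> unit_disc"
    using self_map[of s t] by (simp add: image_subset_iff)
  show "0 \<le> s \<Longrightarrow> z \<in> unit_disc \<Longrightarrow> \<phi> s s z = z"
    using ev[THEN conjunct2, THEN conjunct1] by simp
  show "0 \<le> s \<Longrightarrow> s \<le> u \<Longrightarrow> u \<le> t \<Longrightarrow> z \<in> unit_disc \<Longrightarrow> \<phi> s t z = \<phi> u t (\<phi> s u z)"
    using ev[THEN conjunct2, THEN conjunct2, THEN conjunct1] by simp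
qed

lemma evolution_family_continuous_on:
  assumes "1 \<le> d" "evolution_family d \<phi>" "z \<in> unit_disc" "0 \<le> s"
  shows "continuous_on {s..t} (\<lambda>u. \<phi> s u z)"
proof (cases "s \<le> t")
  case st: True
  \<comment> \<open>the horizon \<open>t + 1\<close> is positive even when \<open>s = t = 0\<close>\<close>
  have "0 < t + 1" using st assms(4) by simp
  then obtain K where K: "continuous_on {0..t + 1} K"
    "\<forall>s u v. 0 \<le> s \<and> s \<le> u \<and> u \<le> v \<and> v \<le> t + 1 \<longrightarrow>
       cmod (\<phi> s u z - \<phi> s v z) \<le> K v - K u"
    using evolution_family_modulus[OF assms(1-3)] by blast
  have dist_le: "dist (\<phi> s u z) (\<phi> s v z) \<le> dist (K u) (K v)" if "u \<in> {s..t}" "v \<in> {s..t}" for u v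
    using K(2)[rule_format, of s u v] K(2)[rule_format, of s v u] that assms(4)
    by (cases "u \<le> v") (auto simp: dist_norm norm_minus_commute)
  have "continuous_on {s..t} K"
    by (rule continuous_on_subset[OF K(1)]) (use assms(4) in auto)
  then have "\<exists>\<delta>>0. \<forall>v\<in>{s..t}. dist v u < \<delta> \<longrightarrow> dist (K v) (K u) < e"
    if "u \<in> {s..t}" "0 < e" for u e
    using that unfolding continuous_on_iff by blast
  then show ?thesis
    unfolding continuous_on_iff by (meson dist_le order_le_less_trans)
qed simp

theorem corollary6p3:
  fixes d :: ennreal and \<phi> :: "real \<Rightarrow> real \<Rightarrow> complex \<Rightarrow> complex"
  assumes "1 \<le> d"
    and "evolution_family d \<phi>"
  shows "\<forall>s t. 0 \<le> s \<and> s \<le> t \<longrightarrow> inj_on (\<phi> s t) unit_disc"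
proof (intro allI impI inj_onI, rule ccontr)
  fix s t z w
  assume "0 \<le> s \<and> s \<le> t" and zw: "z \<in> unit_disc" "w \<in> unit_disc" "\<phi> s t z = \<phi> s t w" "z \<noteq> w"
  then have st: "0 \<le> s" "s \<le> t" by auto
  note ev = evolution_familyD[OF assms(2)]
  note holo = ev(1) and maps = ev(2) and refl = ev(3) and comp = ev(4)
  note cont = evolution_family_continuous_on[OF assms _ st(1)]

  define A where "A = {u \<in> {s..t}. \<phi> s u z = \<phi> s u w}"
  define v where "v = Inf A"
  have "bdd_below A"
    unfolding A_def by (rule bdd_belowI[of _ s]) auto
  have "closed A"
  proof -
    have "closed {u \<in> {s..t}. \<phi> s u z - \<phi> s u w = 0}"
      by (intro continuous_closed_preimage_constant continuous_on_diff cont zw) auto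
    then show ?thesis by (simp add: A_def)
  qed
  moreover have "t \<in> A"
    using zw st by (simp add: A_def)
  ultimately have "v \<in> A"
    unfolding v_def using closed_contains_Inf[OF _ \<open>bdd_below A\<close>] by blast
  then have v: "s \<le> v" "v \<le> t" "\<phi> s v z = \<phi> s v w"
    by (auto simp: A_def)
  have "s \<noteq> v"
    using v(3) zw refl st(1) by auto
  with v(1) have "s < v" by simp
  have before: "\<phi> s u z \<noteq> \<phi> s u w" if "s \<le> u" "u < v" for u
    using cInf_lower[OF _ \<open>bdd_below A\<close>, of u] that v(2) unfolding v_def A_def by fastforce

  define K where "K = convex hull ((\<lambda>u. \<phi> s u z) ` {s..t} \<union> (\<lambda>u. \<phi> s u w) ` {s..t})"
  have K: "compact K" "convex K"
    unfolding K_def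
    by (intro compact_convex_hull compact_Un compact_continuous_image cont zw compact_Icc
        convex_convex_hull)+
  have "K \<subseteq> unit_disc"
    unfolding K_def by (rule hull_minimal) (use maps st zw in auto)
  have inK: "\<phi> s u z \<in> K" "\<phi> s u w \<in> K" if "s \<le> u" "u \<le> t" for u
    unfolding K_def using that by (auto intro!: hull_inc)

  \<comment> \<open>a sequence in \<open>{s..<v}\<close> that increases from \<open>s\<close> to \<open>v\<close>\<close>
  define u where "u n = v - (v - s) / real (Suc n)" for n
  have u: "s \<le> u n" "u n < v" for n
  proof -
    have "(v - s) / real (Suc n) \<le> (v - s) / 1"
      using \<open>s < v\<close> by (intro divide_left_mono) auto
    then show "s \<le> u n" by (simp add: u_def)
    show "u n < v" using \<open>s < v\<close> by (simp add: u_def)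
  qed
  have "(\<lambda>n. v - (v - s) * inverse (real (Suc n))) \<longlonglongrightarrow> v - (v - s) * 0"
    by (intro tendsto_intros LIMSEQ_inverse_real_of_nat)
  then have ulim: "u \<longlonglongrightarrow> v"
    by (simp add: u_def[abs_def] divide_inverse)

  have "\<forall>\<^sub>F n in sequentially. inj_on (\<phi> (u n) v) K"
  proof (rule eventually_inj_on_if_tendsto_id[OF open_ball _ _ _ K \<open>K \<subseteq> unit_disc\<close>])
    have u': "0 \<le> u n" "u n \<le> v" for n
      using u[of n] st by auto
    show "\<phi> (u n) v holomorphic_on unit_disc" for n
      using holo[OF u'] .
    show "cmod (\<phi> (u n) v x) \<le> 1" if "x \<in> unit_disc" for n x
      using maps[OF u' that, of n] by simp
    show "(\<lambda>n. \<phi> (u n) v x) \<longlonglongrightarrow> x" if x: "x \<in> unit_disc" for x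
    proof -
      have "0 < v" using \<open>s < v\<close> st by simp
      then obtain \<kappa> where \<kappa>: "continuous_on {0..v} \<kappa>"
        "\<forall>a b c. 0 \<le> a \<and> a \<le> b \<and> b \<le> c \<and> c \<le> v \<longrightarrow>
           cmod (\<phi> a b x - \<phi> a c x) \<le> \<kappa> c - \<kappa> b"
        using evolution_family_modulus[OF assms x] by blast
      have "(\<lambda>n. \<kappa> (u n)) \<longlonglongrightarrow> \<kappa> v"
        by (rule continuous_on_tendsto_compose[OF \<kappa>(1) ulim]) (use u' \<open>0 < v\<close> in auto)
      then have "(\<lambda>n. \<kappa> v - \<kappa> (u n)) \<longlonglongrightarrow> \<kappa> v - \<kappa> v"
        by (intro tendsto_intros)
      then have lim0: "(\<lambda>n. \<kappa> v - \<kappa> (u n)) \<longlonglongrightarrow> 0" by simp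
      have "cmod (\<phi> (u n) v x - x) \<le> \<kappa> v - \<kappa> (u n)" for n
        using \<kappa>(2)[rule_format, of "u n" "u n" v] u'[of n] refl[OF u'(1) x, of n]
        by (simp add: norm_minus_commute)
      then have "(\<lambda>n. \<phi> (u n) v x - x) \<longlonglongrightarrow> 0"
        by (rule Lim_null_comparison[OF always_eventually[OF allI] lim0])
      then show ?thesis by (simp add: LIM_zero_iff)
    qed
  qed
  then obtain n where n: "inj_on (\<phi> (u n) v) K"
    using eventually_happens'[OF sequentially_bot] by blast
  have "\<phi> (u n) v (\<phi> s (u n) z) = \<phi> (u n) v (\<phi> s (u n) w)"
    using v(3) comp[of s "u n" v] u[of n] st zw by (simp add: less_imp_le)
  then have "\<phi> s (u n) z = \<phi> s (u n) w"
  proof (rule inj_onD[OF n])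
    have "u n \<le> t" using u(2)[of n] v(2) by simp
    then show "\<phi> s (u n) z \<in> K" "\<phi> s (u n) w \<in> K" using inK u(1) by blast+
  qed
  with before[OF u] show False by simp
qed

end
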